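(* Let $L$ be a denumerable (countably infinite) set (a language) and let $C$ be a finite consequence operator on $\mathcal{P}(L)$. Then there exists a denumerable (countably infinite) collection of pairwise distinct general rules of inference $RI(L)$ on $L$ each member of which generates $C$, i.e. satisfies $RI(L)\Rightarrow C$.
   Context: $\mathcal{P}(L)$ is the power set of $L$ and $\mathcal{F}(X)$ is the set of all finite subsets of $X$. A finite consequence operator on $\mathcal{P}(L)$ is a map $C\colon\mathcal{P}(L)\to\mathcal{P}(L)$ such that for all $X,Y\subset L$: (1) $X\subset C(X)=C(C(X))$; (2) if $X\subset Y$, then $C(X)\subset C(Y)$; (3) $C(X)=\bigcup\{C(F)\mid F\in\mathcal{F}(X)\}$. A general rules of inference on $L$ (which determines a general logic-system) is a finite or infinite set $RI(L)$ of relations on $L$, each of which is $n$-ary for some $n\geq 1$. A deduction from $X\subset L$ using $RI(L)$ is a finite sequence $b_1,\ldots,b_m$ ($m\geq 1$) of members of $L$ such that for each $i$ at least one of the following holds: $b_i\in X$; $b_i$ is a member of some unary relation in $RI(L)$; there are $j\geq 1$, a $(j+1)$-ary relation $R\in RI(L)$ and a tuple $(a_1,\ldots,a_j,a_{j+1})\in R$ with $a_1,\ldots,a_j\in\{b_1,\ldots,b_{i-1}\}$ and $b_i=a_{j+1}$. One writes $X\vdash x$ if there is such a deduction whose last term is $x$. The notation $RI(L)\Rightarrow C$ means that $C(X)=\{x\in L\mid X\vdash x\}$ for all $X\subset L$. *)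

theory Defs
  imports Main "HOL-Library.Countable_Set" "HOL-Library.FuncSet"
begin

definition finite_consequence_operator :: "'a set \<Rightarrow> ('a set \<Rightarrow> 'a set) \<Rightarrow> bool" where
  "finite_consequence_operator L C \<longleftrightarrow>
     C \<in> Pow L \<rightarrow> Pow L \<and>
     (\<forall>X. X \<subseteq> L \<longrightarrow> X \<subseteq> C X \<and> C X = C (C X)) \<and>
     (\<forall>X Y. X \<subseteq> L \<longrightarrow> Y \<subseteq> L \<longrightarrow> X \<subseteq> Y \<longrightarrow> C X \<subseteq> C Y) \<and>
     (\<forall>X. X \<subseteq> L \<longrightarrow> C X = (\<Union>F\<in>Fpow X. C F))"

text \<open>An n-tuple over L is a list of length n with entries in L. As in set theory,
  the empty relation is n-ary for every n.\<close>

definition nary_relation :: "'a set \<Rightarrow> nat \<Rightarrow> 'a list set \<Rightarrow> bool" where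
  "nary_relation L n R \<longleftrightarrow> (\<forall>t\<in>R. length t = n \<and> set t \<subseteq> L)"

definition general_rules_of_inference :: "'a set \<Rightarrow> 'a list set set \<Rightarrow> bool" where
  "general_rules_of_inference L RI \<longleftrightarrow> (\<forall>R\<in>RI. \<exists>n\<ge>1. nary_relation L n R)"

text \<open>The terms of a deduction are indexed from 0, so the terms preceding \<open>bs ! i\<close>
  are those of \<open>take i bs\<close>.\<close>

definition deduction :: "'a set \<Rightarrow> 'a list set set \<Rightarrow> 'a set \<Rightarrow> 'a list \<Rightarrow> bool" where
  "deduction L RI X bs \<longleftrightarrow>
     bs \<noteq> [] \<and> set bs \<subseteq> L \<and>
     (\<forall>i<length bs.
        bs ! i \<in> X \<or>
        (\<exists>R\<in>RI. nary_relation L 1 R \<and> [bs ! i] \<in> R) \<or>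
        (\<exists>j\<ge>1. \<exists>R\<in>RI. nary_relation L (j + 1) R \<and>
           (\<exists>as. length as = j \<and> set as \<subseteq> set (take i bs) \<and> as @ [bs ! i] \<in> R)))"

definition deducible :: "'a set \<Rightarrow> 'a list set set \<Rightarrow> 'a set \<Rightarrow> 'a \<Rightarrow> bool" where
  "deducible L RI X x \<longleftrightarrow> (\<exists>bs. deduction L RI X bs \<and> last bs = x)"

definition generates :: "'a set \<Rightarrow> 'a list set set \<Rightarrow> ('a set \<Rightarrow> 'a set) \<Rightarrow> bool" where
  "generates L RI C \<longleftrightarrow> (\<forall>X. X \<subseteq> L \<longrightarrow> C X = {x \<in> L. deducible L RI X x})"

end

(* The relations collecting, for each arity, all instances of the consequence relation of C generate C,
   and a rule set stays generating when further sound rules are added.  Each x in L gives the sound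
   singleton rule (x, x), which is none of the former relations because L has other elements. *)

theory Submission
  imports Defs
begin

text \<open>The last entry of a tuple is the conclusion and the earlier entries are the premises. A
  one-entry tuple has no premises, so its entry must lie in \<open>C {}\<close>.\<close>

definition sound_rule :: "('a set \<Rightarrow> 'a set) \<Rightarrow> 'a list set \<Rightarrow> bool" where
  "sound_rule C R \<longleftrightarrow> (\<forall>t\<in>R. last t \<in> C (set (butlast t)))"

definition full_rule :: "'a set \<Rightarrow> ('a set \<Rightarrow> 'a set) \<Rightarrow> nat \<Rightarrow> 'a list set" where
  "full_rule L C n = {t. length t = n \<and> set t \<subseteq> L \<and> last t \<in> C (set (butlast t))}"

lemma nary_full_rule: "nary_relation L n (full_rule L C n)"
  by (auto simp: nary_relation_def full_rule_def)

lemma sound_full_rule: "sound_rule C (full_rule L C n)"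
  by (auto simp: sound_rule_def full_rule_def)

lemma finite_consequence_operatorD:
  assumes "finite_consequence_operator L C" and "X \<subseteq> L"
  shows "C X \<subseteq> L" and "X \<subseteq> C X" and "C (C X) = C X"
    and "Y \<subseteq> X \<Longrightarrow> C Y \<subseteq> C X" and "C X = (\<Union>F\<in>Fpow X. C F)"
proof -
  note C = assms(1)[unfolded finite_consequence_operator_def]
  show "C X \<subseteq> L" using funcset_mem[OF conjunct1[OF C], of X] assms(2) by simp
  show "X \<subseteq> C X"
    using conjunct1[OF conjunct2[OF C], rule_format, OF assms(2)] by (rule conjunct1)
  show "C (C X) = C X"
    using conjunct1[OF conjunct2[OF C], rule_format, OF assms(2)] by (metis (no_types))
  show "C Y \<subseteq> C X" if "Y \<subseteq> X"
    using conjunct1[OF conjunct2[OF conjunct2[OF C]], rule_format, of Y X] assms(2) that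
    by (meson order_trans)
  show "C X = (\<Union>F\<in>Fpow X. C F)"
    using conjunct2[OF conjunct2[OF conjunct2[OF C]], rule_format, OF assms(2)] .
qed

text \<open>The set \<open>C X\<close> contains \<open>X\<close> and is closed under sound rules:
  premises in \<open>C X\<close> put the conclusion in \<open>C (C X) = C X\<close>. Strong
  induction on the position in the deduction then applies.\<close>

lemma deduction_sound:
  assumes C: "finite_consequence_operator L C" and sound: "\<forall>R\<in>RI. sound_rule C R"
    and X: "X \<subseteq> L" and bs: "deduction L RI X bs"
  shows "set bs \<subseteq> C X"
proof -
  note infl = finite_consequence_operatorD(2)[OF C X]
    and idem = finite_consequence_operatorD(3)[OF C X]
    and CXL = finite_consequence_operatorD(1)[OF C X]
    and mono = finite_consequence_operatorD(4)[OF C]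
  have "bs ! i \<in> C X" if "i < length bs" for i
    using that
  proof (induction i rule: less_induct)
    case (less i)
    have "bs ! i \<in> X \<or> (\<exists>R\<in>RI. nary_relation L 1 R \<and> [bs ! i] \<in> R) \<or>
        (\<exists>j\<ge>1. \<exists>R\<in>RI. nary_relation L (j + 1) R \<and>
           (\<exists>as. length as = j \<and> set as \<subseteq> set (take i bs) \<and> as @ [bs ! i] \<in> R))"
      using bs less.prems unfolding deduction_def by simp
    then consider (hyp) "bs ! i \<in> X"
      | (unary) R where "R \<in> RI" "[bs ! i] \<in> R"
      | (rule) R as where "R \<in> RI" "set as \<subseteq> set (take i bs)" "as @ [bs ! i] \<in> R"
      by blast
    then show ?case
    proof cases
      case hyp
      then show ?thesis using infl by blast
    next
      case unary
      then have "last [bs ! i] \<in> C (set (butlast [bs ! i]))"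
        using sound unfolding sound_rule_def by blast
      then have "bs ! i \<in> C {}" by simp
      then show ?thesis using mono[OF X, of "{}"] by blast
    next
      case rule
      have "set (take i bs) \<subseteq> C X"
      proof
        fix y assume "y \<in> set (take i bs)"
        then obtain k where "k < i" "k < length bs" "y = bs ! k"
          by (auto simp: in_set_conv_nth)
        then show "y \<in> C X" using less.IH by simp
      qed
      \<comment> \<open>Monotonicity is used below \<open>C X\<close> rather than below
        \<open>X\<close>; idempotence then collapses \<open>C (C X)\<close>.\<close>
      then have "C (set as) \<subseteq> C X"
        using mono[OF CXL, of "set as"] rule(2) unfolding idem by simp
      moreover have "last (as @ [bs ! i]) \<in> C (set (butlast (as @ [bs ! i])))"
        using rule sound unfolding sound_rule_def by blast
      ultimately show ?thesis by auto
    qed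
  qed
  then show ?thesis by (auto simp: in_set_conv_nth)
qed

text \<open>Finiteness of \<open>C\<close> gives a finite \<open>F\<close> inside \<open>X\<close>
  with \<open>x\<close> in \<open>C F\<close>. Listing \<open>F\<close> and then appending
  \<open>x\<close> is already a deduction, with one rule application at the end.\<close>

lemma deducible_of_full_rules:
  assumes C: "finite_consequence_operator L C" and full: "\<forall>n\<ge>1. full_rule L C n \<in> RI"
    and X: "X \<subseteq> L" and x: "x \<in> C X"
  shows "deducible L RI X x"
proof -
  have xL: "x \<in> L" using finite_consequence_operatorD(1)[OF C X] x by blast
  obtain F where F: "finite F" "F \<subseteq> X" "x \<in> C F"
    using x unfolding finite_consequence_operatorD(5)[OF C X] by (auto simp: Fpow_def)
  obtain as where as: "set as = F" using finite_list[OF F(1)] by blast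
  have mem: "as @ [x] \<in> full_rule L C (length as + 1)"
    using as F xL X by (auto simp: full_rule_def)
  have "deduction L RI X (as @ [x])"
    unfolding deduction_def
  proof (intro conjI allI impI)
    show "set (as @ [x]) \<subseteq> L" using as F X xL by auto
    fix i assume "i < length (as @ [x])"
    \<comment> \<open>An empty \<open>F\<close> is separated because a rule with premises needs
      \<open>j\<close> at least 1; in that case \<open>x\<close> is in \<open>C {}\<close> and
      enters through the unary full rule.\<close>
    then consider "i < length as" | "i = length as" "as = []" | "i = length as" "length as \<ge> 1"
      by (cases "i < length as"; cases as) auto
    then show "(as @ [x]) ! i \<in> X \<or>
        (\<exists>R\<in>RI. nary_relation L 1 R \<and> [(as @ [x]) ! i] \<in> R) \<or>
        (\<exists>j\<ge>1. \<exists>R\<in>RI. nary_relation L (j + 1) R \<and>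
           (\<exists>as'. length as' = j \<and> set as' \<subseteq> set (take i (as @ [x])) \<and> as' @ [(as @ [x]) ! i] \<in> R))"
    proof cases
      case 1
      then show ?thesis using as F by (auto simp: nth_append)
    next
      case 2
      then show ?thesis using mem full nary_full_rule[of L 1 C] by auto
    next
      case 3
      then show ?thesis
        using mem full nary_full_rule[of L "length as + 1" C]
        by (intro disjI2 exI[of _ "length as"] conjI bexI[of _ "full_rule L C (length as + 1)"]
            exI[of _ as]) auto
    qed
  qed simp
  then show ?thesis unfolding deducible_def by fastforce
qed

text \<open>Soundness bounds the deducible elements by \<open>C X\<close>, and the full rules reach
  all of it. Leaving \<open>RI\<close> open to further sound rules makes room for a marker that
  tells rule sets apart.\<close>

lemma generates_of_sound_full:
  assumes C: "finite_consequence_operator L C" and "\<forall>R\<in>RI. sound_rule C R"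
    and "\<forall>n\<ge>1. full_rule L C n \<in> RI"
  shows "generates L RI C"
  unfolding generates_def
proof (intro allI impI)
  fix X assume X: "X \<subseteq> L"
  note CXL = finite_consequence_operatorD(1)[OF C X]
  have "x \<in> C X" if ded: "deducible L RI X x" for x
  proof -
    obtain bs where bs: "deduction L RI X bs" "last bs = x"
      using ded unfolding deducible_def by blast
    then have "x \<in> set bs" using last_in_set[of bs] by (simp add: deduction_def)
    then show ?thesis using deduction_sound[OF C assms(2) X bs(1)] by blast
  qed
  then show "C X = {x \<in> L. deducible L RI X x}"
    using deducible_of_full_rules[OF C assms(3) X] CXL by blast
qed

theorem mainTheorem7:
  fixes L :: "'a set" and C :: "'a set \<Rightarrow> 'a set"
  assumes "countable L" and "infinite L"
    and "finite_consequence_operator L C"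
  shows "\<exists>\<R> :: 'a list set set set. countable \<R> \<and> infinite \<R> \<and>
           (\<forall>RI\<in>\<R>. general_rules_of_inference L RI \<and> generates L RI C)"
proof -
  \<comment> \<open>The singleton \<open>{[x, x]}\<close> is the marker of \<open>x\<close>. The
    full rules start at arity 1, the least arity allowed for a rule.\<close>
  define RI where "RI x = insert {[x, x]} (full_rule L C ` {1..})" for x
  have refl: "y \<in> C {y}" if "y \<in> L" for y
    using finite_consequence_operatorD(2)[OF assms(3), of "{y}"] that by simp
  \<comment> \<open>Length forces \<open>n = 2\<close>, but the binary full rule contains
    \<open>[y, y]\<close> for every \<open>y\<close> in \<open>L\<close>, and infinite
    \<open>L\<close> has some \<open>y\<close> other than \<open>x\<close>.\<close>
  have not_full: "{[x, x]} \<noteq> full_rule L C n" for x n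
  proof
    assume eq: "{[x, x]} = full_rule L C n"
    have "[x, x] \<in> full_rule L C n" by (simp flip: eq)
    then have n: "n = 2" by (simp add: full_rule_def)
    have "infinite (L - {x})" using assms(2) by simp
    then obtain y where y: "y \<in> L" "y \<noteq> x"
      using infinite_imp_nonempty by blast
    then have "[y, y] \<in> full_rule L C n"
      using refl n by (simp add: full_rule_def)
    then show False using y by (simp flip: eq)
  qed
  have "inj_on RI L"
  proof (rule inj_onI)
    fix x y assume "RI x = RI y"
    moreover have "{[x, x]} \<in> RI x" unfolding RI_def by (rule insertI1)
    ultimately have "{[x, x]} \<in> RI y" by (rule subst)
    \<comment> \<open>The marker of \<open>x\<close> cannot be one of the full rules in
      \<open>RI y\<close>, so it is the marker of \<open>y\<close>.\<close>
    then have "{[x, x]} = {[y, y]}"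
      unfolding RI_def using not_full by (elim insertE imageE) simp_all
    then show "x = y" by simp
  qed
  then have "infinite (RI ` L)" using assms(2) finite_imageD by blast
  moreover have "general_rules_of_inference L (RI x) \<and> generates L (RI x) C" if "x \<in> L" for x
  proof
    have "nary_relation L 2 {[x, x]}" using that by (simp add: nary_relation_def)
    then have "\<exists>n\<ge>1. nary_relation L n {[x, x]}" by (intro exI[of _ 2]) simp
    then show "general_rules_of_inference L (RI x)"
      using nary_full_rule[of L _ C] by (auto simp: general_rules_of_inference_def RI_def)
    \<comment> \<open>The marker only infers \<open>x\<close> from \<open>x\<close>, which is sound
      because \<open>C\<close> is extensive.\<close>
    have "sound_rule C {[x, x]}" using refl[OF that] by (simp add: sound_rule_def)
    then show "generates L (RI x) C"
      by (intro generates_of_sound_full[OF assms(3)]) (simp_all add: RI_def sound_full_rule)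
  qed
  ultimately show ?thesis using assms(1) by (intro exI[of _ "RI ` L"]) auto
qed

end
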